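(* Let $X,U,\mathcal P,\mathcal R\in\mathbb R^n$, and let $E_T=(E_T^i)$, $E_R^{ij}$, $E_D$, $E_S=(E_S^i)$ and $Q^{0ijN}$, $Q^{0ijk}$, $Q^{ijkN}$, $Q^{ijkl}$ be the polynomials in $(X,U,\mathcal P,\mathcal R)$ defined in the context. Then for all indices $i,j,k,l\in\{1,\dots,n\}$ the following identities hold: $$Q^{0ijN}=\tfrac12\,\epsilon^{ij}(E_T,E_S)-E_D\,E_R^{ij},$$ $$Q^{0ijk}=\tfrac32\,E_R^{[ij}E_S^{k]},$$ $$Q^{ijkN}=-3\,E_R^{[ij}E_T^{k]},$$ $$Q^{ijkl}=\frac{6}{E_D}\,E_R^{[ij}E_S^{k}E_T^{l]},$$ the last one wherever $E_D\neq0$.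
   Context: $\langle\cdot,\cdot\rangle$ is the standard scalar product on $\mathbb R^n$, $|X|^2=\langle X,X\rangle$, indices $i,j,k,l$ run over $1,\dots,n$ and are raised and lowered with the Euclidean metric, repeated indices are summed, and $N=n+1$ is only a label. Square brackets denote total antisymmetrization over the enclosed indices, normalized by $1/m!$ for $m$ indices. The elementary alternating tensor $\epsilon^{i_1\dots i_m}$ acts on vectors $Y_1,\dots,Y_m\in\mathbb R^n$ by $\epsilon^{i_1\dots i_m}(Y_1,\dots,Y_m)=\det\big((Y_b)^{i_a}\big)_{a,b=1}^m$. Basis conserved quantities: $$E_T^i=\mathcal P^i,\qquad E_R^{ij}=\epsilon^{ij}(X,\mathcal P)+\epsilon^{ij}(U,\mathcal R),\qquad E_D=\langle X,\mathcal P\rangle+\langle U,\mathcal R\rangle,$$ $$E_S^i=|X|^2\mathcal P^i+2\langle X,U\rangle\mathcal R^i-2\big(\langle X,\mathcal P\rangle+\langle U,\mathcal R\rangle\big)X^i-2\big(1+\langle X,\mathcal R\rangle\big)U^i.$$ Tractor conserved quantities in phase-space variables: $$Q^{0ijN}=-\langle\mathcal R,U\rangle\epsilon^{ij}(U,\mathcal R)+\epsilon^{ij}(U,\mathcal P)-\epsilon^{ijk}(U,\mathcal R,\mathcal P)X_k,$$ $$Q^{0ijk}=-\Big(\langle U,\mathcal R\rangle\epsilon^{ijk}(X,U,\mathcal R)+\epsilon^{ijk}(U,X,\mathcal P)+\tfrac12|X|^2\epsilon^{ijk}(U,\mathcal R,\mathcal P)+\epsilon^{ijkl}(X,U,\mathcal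 R,\mathcal P)X_l\Big),$$ $$Q^{ijkN}=-\epsilon^{ijk}(U,\mathcal R,\mathcal P),\qquad Q^{ijkl}=-\epsilon^{ijkl}(X,U,\mathcal R,\mathcal P).$$ Background: for a curve $X(t)$ in $\mathbb R^n$ with velocity $U\ne0$, $u=\sqrt{\langle U,U\rangle}$, acceleration $A$, and $A'=dA/dt$, one puts $\mathcal R=u^{-2}A-2u^{-4}\langle U,A\rangle U$ and $\mathcal P=-u^{-2}\big(A'-u^{-2}|A|^2U-2u^{-2}\langle A,U\rangle A+4u^{-4}\langle A,U\rangle^2U-2u^{-2}\langle A',U\rangle U\big)$. Under this substitution the quantities $Q$ above are the phase-space form of $Q^{0ijN}=3u^{-4}\langle U,A\rangle\epsilon^{ij}(U,A)-u^{-2}\epsilon^{ij}(U,A')+u^{-4}\epsilon^{ijl}(U,A,A')X_l$, $Q^{0ijk}=3u^{-4}\langle U,A\rangle\epsilon^{ijk}(X,U,A)-u^{-2}\epsilon^{ijk}(X,U,A')+\frac12|X|^2u^{-4}\epsilon^{ijk}(U,A,A')+u^{-4}\epsilon^{ijkl}(X,U,A,A')X_l$, $Q^{ijkN}=u^{-4}\epsilon^{ijk}(U,A,A')$, $Q^{ijkl}=u^{-4}\epsilon^{ijkl}(X,U,A,A')$. *)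

theory Defs
  imports
    "HOL-Analysis.Finite_Cartesian_Product"
    "Jordan_Normal_Form.Determinant"
begin

no_notation Matrix.vec_index (infixl "$" 100)
no_notation Matrix.scalar_prod (infix "\<bullet>" 70)
unbundle inner_syntax

text \<open>
  Vectors of $R^n$ have type \<^typ>\<open>real ^ 'n\<close>, so an index is an element of the finite type
  \<^typ>\<open>'n\<close>; the metric is Euclidean, so upper and lower components agree.
  Tuples of indices and of vectors are lists, with positions counted from 0.  In the definitions
  below \<open>P\<close> and \<open>R\<close> stand for the script letters of the momenta.
\<close>

definition eps :: "'n::finite list \<Rightarrow> (real ^ 'n) list \<Rightarrow> real" where
  "eps is Ys =
     Determinant.det (Matrix.mat (length is) (length is) (\<lambda>(a, b). (Ys ! b) $ (is ! a)))"

definition antisymmetrize :: "('n list \<Rightarrow> real) \<Rightarrow> 'n list \<Rightarrow> real" where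
  "antisymmetrize T is =
     (\<Sum>p | p permutes {..<length is}. real_of_int (sign p) * T (permute_list p is))
       / fact (length is)"

definition E_T :: "real ^ 'n \<Rightarrow> real ^ 'n \<Rightarrow> real ^ 'n \<Rightarrow> real ^ 'n \<Rightarrow> real ^ 'n" where
  "E_T X U P R = P"

definition E_R ::
  "real ^ 'n \<Rightarrow> real ^ 'n \<Rightarrow> real ^ 'n \<Rightarrow> real ^ 'n \<Rightarrow> 'n::finite \<Rightarrow> 'n \<Rightarrow> real" where
  "E_R X U P R i j = eps [i, j] [X, P] + eps [i, j] [U, R]"

definition E_D :: "real ^ 'n::finite \<Rightarrow> real ^ 'n \<Rightarrow> real ^ 'n \<Rightarrow> real ^ 'n \<Rightarrow> real" where
  "E_D X U P R = X \<bullet> P + U \<bullet> R"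

definition E_S ::
  "real ^ 'n::finite \<Rightarrow> real ^ 'n \<Rightarrow> real ^ 'n \<Rightarrow> real ^ 'n \<Rightarrow> real ^ 'n" where
  "E_S X U P R =
     (norm X)\<^sup>2 *\<^sub>R P + (2 * (X \<bullet> U)) *\<^sub>R R
       - (2 * (X \<bullet> P + U \<bullet> R)) *\<^sub>R X - (2 * (1 + X \<bullet> R)) *\<^sub>R U"

text \<open>
  The tractor conserved quantities, named after their index pattern: \<open>0\<close> and \<open>N\<close> are the two
  label slots, and each \<open>i\<close> stands for one index of $R^n$.
\<close>

definition Q_0iiN ::
  "real ^ 'n \<Rightarrow> real ^ 'n \<Rightarrow> real ^ 'n \<Rightarrow> real ^ 'n \<Rightarrow> 'n::finite \<Rightarrow> 'n \<Rightarrow> real" where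
  "Q_0iiN X U P R i j =
     - (R \<bullet> U) * eps [i, j] [U, R] + eps [i, j] [U, P]
       - (\<Sum>k\<in>UNIV. eps [i, j, k] [U, R, P] * X $ k)"

definition Q_0iii ::
  "real ^ 'n \<Rightarrow> real ^ 'n \<Rightarrow> real ^ 'n \<Rightarrow> real ^ 'n \<Rightarrow> 'n::finite \<Rightarrow> 'n \<Rightarrow> 'n \<Rightarrow> real" where
  "Q_0iii X U P R i j k =
     - ((U \<bullet> R) * eps [i, j, k] [X, U, R] + eps [i, j, k] [U, X, P]
        + 1 / 2 * (norm X)\<^sup>2 * eps [i, j, k] [U, R, P]
        + (\<Sum>l\<in>UNIV. eps [i, j, k, l] [X, U, R, P] * X $ l))"

definition Q_iiiN ::
  "real ^ 'n \<Rightarrow> real ^ 'n \<Rightarrow> real ^ 'n \<Rightarrow> real ^ 'n \<Rightarrow> 'n::finite \<Rightarrow> 'n \<Rightarrow> 'n \<Rightarrow> real" where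
  "Q_iiiN X U P R i j k = - eps [i, j, k] [U, R, P]"

definition Q_iiii ::
  "real ^ 'n \<Rightarrow> real ^ 'n \<Rightarrow> real ^ 'n \<Rightarrow> real ^ 'n \<Rightarrow> 'n::finite \<Rightarrow> 'n \<Rightarrow> 'n \<Rightarrow> 'n \<Rightarrow> real" where
  "Q_iiii X U P R i j k l = - eps [i, j, k, l] [X, U, R, P]"

end

theory Submission
  imports Defs
begin

text \<open>
  Antisymmetrizing $Y_1^{i_1} \cdots Y_m^{i_m}$ yields $\epsilon^{i_1 \dots i_m}(Y_1, \dots, Y_m)/m!$.
  Since $E_R = X \wedge P + U \wedge R$, the antisymmetrized right-hand sides are therefore multiples
  of $(X \wedge P + U \wedge R) \wedge V$ with $V$ one of $E_S$, $E_T$, $E_S \wedge E_T$, and are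
  evaluated by multilinearity and alternation.
  On the left-hand side, Laplace expansion along the last index turns the contractions with $X$
  into scalar products.
\<close>

text \<open>Permuting the index list permutes the rows of the matrix behind \<open>eps\<close>, so
  the sum over \<open>p\<close> is the Leibniz formula with one entry \<open>(p b, b)\<close> from
  each column \<open>b\<close>.\<close>

lemma antisymmetrize_prod:
  assumes "length Ys = length is"
  shows "antisymmetrize (\<lambda>m. \<Prod>b<length is. Ys ! b $ (m ! b)) is = eps is Ys / fact (length is)"
proof -
  have *: "(\<Prod>b<length is. Ys ! b $ (permute_list p is ! b))
      = (\<Prod>b = 0..<length is. Matrix.mat (length is) (length is) (\<lambda>(a, b). Ys ! b $ (is ! a)) $$ (p b, b))"
    if "p permutes {..<length is}" for p
    using that permutes_in_image[OF that]
    by (auto intro!: prod.cong simp: permute_list_nth atLeast0LessThan)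
  show ?thesis
    unfolding antisymmetrize_def eps_def
    by (subst det_col[of _ "length is"])
      (auto intro!: sum.cong simp: * atLeast0LessThan)
qed

text \<open>Rows belong to indices and columns to vectors: expanding along the last row strips off
  the index \<open>i\<close>, and deleting column \<open>b\<close> drops the vector
  \<open>Ys ! b\<close>. Iterating this reduces every \<open>eps\<close> to a polynomial in
  components.\<close>

lemma eps_snoc:
  assumes "length Ys = Suc (length is)"
  shows "eps (is @ [i]) Ys =
    (\<Sum>b<Suc (length is). (-1) ^ (length is + b) * (Ys ! b $ i) * eps is (take b Ys @ drop (Suc b) Ys))"
proof -
  let ?n = "length is"
  let ?A = "Matrix.mat (Suc ?n) (Suc ?n) (\<lambda>(a, b). Ys ! b $ ((is @ [i]) ! a))"
  have "mat_delete ?A ?n b =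
      Matrix.mat ?n ?n (\<lambda>(a, c). (take b Ys @ drop (Suc b) Ys) ! c $ (is ! a))"
    if "b < Suc ?n" for b
    using that assms by (intro eq_matI) (auto simp: mat_delete_def nth_append)
  then have "Determinant.det (mat_delete ?A ?n b) = eps is (take b Ys @ drop (Suc b) Ys)"
    if "b < Suc ?n" for b
    using that by (simp add: eps_def)
  then show ?thesis
    using laplace_expansion_row[of ?A "Suc ?n" ?n]
    by (auto simp: eps_def cofactor_def algebra_simps intro!: sum.cong)
qed

lemma eps_1: "eps [i] [A] = A $ i"
  by (simp add: eps_def det_single)

lemma eps_2: "eps [i, j] [A, B] = A $ i * B $ j - B $ i * A $ j"
  using eps_snoc[of "[A, B]" "[i]" j] by (simp add: eps_1)

lemma eps_3:
  "eps [i, j, k] [A, B, C] =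
    A $ k * eps [i, j] [B, C] - B $ k * eps [i, j] [A, C] + C $ k * eps [i, j] [A, B]"
  using eps_snoc[of "[A, B, C]" "[i, j]" k] by (simp add: eval_nat_numeral)

lemma eps_4:
  "eps [i, j, k, l] [A, B, C, D] =
    - A $ l * eps [i, j, k] [B, C, D] + B $ l * eps [i, j, k] [A, C, D]
    - C $ l * eps [i, j, k] [A, B, D] + D $ l * eps [i, j, k] [A, B, C]"
  using eps_snoc[of "[A, B, C, D]" "[i, j, k]" l] by (simp add: eval_nat_numeral)

lemma sum_eps_3:
  "(\<Sum>k\<in>UNIV. eps [i, j, k] [A, B, C] * Y $ k) =
    (A \<bullet> Y) * eps [i, j] [B, C] - (B \<bullet> Y) * eps [i, j] [A, C] + (C \<bullet> Y) * eps [i, j] [A, B]"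
  by (simp add: eps_3 inner_vec_def sum_distrib_right flip: sum.distrib sum_subtractf)
    (simp add: algebra_simps)

lemma sum_eps_4:
  "(\<Sum>l\<in>UNIV. eps [i, j, k, l] [A, B, C, D] * Y $ l) =
    - (A \<bullet> Y) * eps [i, j, k] [B, C, D] + (B \<bullet> Y) * eps [i, j, k] [A, C, D]
    - (C \<bullet> Y) * eps [i, j, k] [A, B, D] + (D \<bullet> Y) * eps [i, j, k] [A, B, C]"
  by (simp add: eps_4 inner_vec_def sum_distrib_right flip: sum.distrib sum_subtractf sum_negf)
    (simp add: algebra_simps)

lemma antisymmetrize_add:
  "antisymmetrize (\<lambda>m. S m + T m) is = antisymmetrize S is + antisymmetrize T is"
  by (simp add: antisymmetrize_def algebra_simps sum.distrib add_divide_distrib)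

lemma antisymmetrize_diff:
  "antisymmetrize (\<lambda>m. S m - T m) is = antisymmetrize S is - antisymmetrize T is"
  by (simp add: antisymmetrize_def algebra_simps sum_subtractf diff_divide_distrib)

text \<open>Each of the two wedges in \<open>E_R\<close> is a difference of two monomials with
  swapped vectors. By alternation both contribute equally, which gives the factor 2/3! =
  1/3.\<close>

lemma antisymmetrize_E_R_3:
  "antisymmetrize (\<lambda>m. E_R X U P R (m ! 0) (m ! 1) * V $ (m ! 2)) [i, j, k] =
     (eps [i, j, k] [X, P, V] + eps [i, j, k] [U, R, V]) / 3"
proof -
  have *: "antisymmetrize (\<lambda>m. A $ (m ! 0) * B $ (m ! 1) * V $ (m ! 2)) [i, j, k]
      = eps [i, j, k] [A, B, V] / 6" for A B
    using antisymmetrize_prod[of "[A, B, V]" "[i, j, k]"]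
    by (simp add: eval_nat_numeral mult.assoc)
  have "(\<lambda>m. E_R X U P R (m ! 0) (m ! 1) * V $ (m ! 2)) =
     (\<lambda>m. (X $ (m ! 0) * P $ (m ! 1) * V $ (m ! 2) - P $ (m ! 0) * X $ (m ! 1) * V $ (m ! 2))
        + (U $ (m ! 0) * R $ (m ! 1) * V $ (m ! 2) - R $ (m ! 0) * U $ (m ! 1) * V $ (m ! 2)))"
    by (simp add: E_R_def eps_2 algebra_simps)
  then show ?thesis
    by (simp only: antisymmetrize_add antisymmetrize_diff *) (simp add: eps_3 eps_2 field_simps)
qed

text \<open>The same count with four indices gives 2/4! = 1/12.\<close>

lemma antisymmetrize_E_R_4:
  "antisymmetrize (\<lambda>m. E_R X U P R (m ! 0) (m ! 1) * V $ (m ! 2) * W $ (m ! 3)) [i, j, k, l] =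
    (eps [i, j, k, l] [X, P, V, W] + eps [i, j, k, l] [U, R, V, W]) / 12"
proof -
  have *: "antisymmetrize (\<lambda>m. A $ (m ! 0) * B $ (m ! 1) * V $ (m ! 2) * W $ (m ! 3)) [i, j, k, l]
      = eps [i, j, k, l] [A, B, V, W] / 24" for A B
    using antisymmetrize_prod[of "[A, B, V, W]" "[i, j, k, l]"]
    by (simp add: eval_nat_numeral mult.assoc)
  have "(\<lambda>m. E_R X U P R (m ! 0) (m ! 1) * V $ (m ! 2) * W $ (m ! 3)) =
     (\<lambda>m. (X $ (m ! 0) * P $ (m ! 1) * V $ (m ! 2) * W $ (m ! 3)
           - P $ (m ! 0) * X $ (m ! 1) * V $ (m ! 2) * W $ (m ! 3))
        + (U $ (m ! 0) * R $ (m ! 1) * V $ (m ! 2) * W $ (m ! 3)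
           - R $ (m ! 0) * U $ (m ! 1) * V $ (m ! 2) * W $ (m ! 3)))"
    by (simp add: E_R_def eps_2 algebra_simps)
  then show ?thesis
    by (simp only: antisymmetrize_add antisymmetrize_diff *) (simp add: eps_4 eps_3 eps_2 field_simps)
qed

theorem theorem4p1:
  fixes X U P R :: "real ^ 'n::finite"
    and i j k l :: 'n
  shows "Q_0iiN X U P R i j
           = 1 / 2 * eps [i, j] [E_T X U P R, E_S X U P R] - E_D X U P R * E_R X U P R i j
       \<and> Q_0iii X U P R i j k
           = 3 / 2 * antisymmetrize (\<lambda>m. E_R X U P R (m ! 0) (m ! 1) * E_S X U P R $ (m ! 2)) [i, j, k]
       \<and> Q_iiiN X U P R i j k
           = - 3 * antisymmetrize (\<lambda>m. E_R X U P R (m ! 0) (m ! 1) * E_T X U P R $ (m ! 2)) [i, j, k]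
       \<and> (E_D X U P R \<noteq> 0 \<longrightarrow>
           Q_iiii X U P R i j k l
             = 6 / E_D X U P R
                 * antisymmetrize (\<lambda>m. E_R X U P R (m ! 0) (m ! 1) * E_S X U P R $ (m ! 2)
                                  * E_T X U P R $ (m ! 3)) [i, j, k, l])"
proof (intro conjI impI)
  let ?S = "E_S X U P R" and ?D = "E_D X U P R"
  have S: "?S $ a = (X \<bullet> X) * P $ a + 2 * (X \<bullet> U) * R $ a - 2 * ?D * X $ a - 2 * (1 + X \<bullet> R) * U $ a" for a
    by (simp add: E_S_def E_D_def power2_norm_eq_inner)
  have S3: "eps [i, j, k] [A, B, ?S] = (X \<bullet> X) * eps [i, j, k] [A, B, P]
      + 2 * (X \<bullet> U) * eps [i, j, k] [A, B, R] - 2 * ?D * eps [i, j, k] [A, B, X]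
      - 2 * (1 + X \<bullet> R) * eps [i, j, k] [A, B, U]" for A B
    by (simp add: eps_3 eps_2 S algebra_simps)
  \<comment> \<open>Expanding \<open>eps\<close> of \<open>[A, B, ?S, C]\<close> along
    \<open>l\<close> leaves \<open>?S\<close> in the middle slot when \<open>A\<close> or
    \<open>B\<close> is removed, so linearity in that slot is needed as well.\<close>
  have S3': "eps [i, j, k] [A, ?S, B] = (X \<bullet> X) * eps [i, j, k] [A, P, B]
      + 2 * (X \<bullet> U) * eps [i, j, k] [A, R, B] - 2 * ?D * eps [i, j, k] [A, X, B]
      - 2 * (1 + X \<bullet> R) * eps [i, j, k] [A, U, B]" for A B
    by (simp add: eps_3 eps_2 S algebra_simps)
  have S4: "eps [i, j, k, l] [A, B, ?S, C] = (X \<bullet> X) * eps [i, j, k, l] [A, B, P, C]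
      + 2 * (X \<bullet> U) * eps [i, j, k, l] [A, B, R, C] - 2 * ?D * eps [i, j, k, l] [A, B, X, C]
      - 2 * (1 + X \<bullet> R) * eps [i, j, k, l] [A, B, U, C]" for A B C
    by (simp add: eps_4 S3 S3' S algebra_simps)
  \<comment> \<open>The \<open>X\<close> term of \<open>?S\<close> yields \<open>?D\<close> times X
    \<and> P, which cancels against the same term of \<open>?D * E_R\<close>.\<close>
  show "Q_0iiN X U P R i j = 1 / 2 * eps [i, j] [E_T X U P R, ?S] - ?D * E_R X U P R i j"
    unfolding Q_0iiN_def sum_eps_3 E_R_def E_T_def eps_2 S E_D_def
    by (simp add: inner_commute field_simps)
  \<comment> \<open>The contraction with \<open>X\<close> supplies -|X|^2 U \<and> R \<and> P,
    reversing the sign of the explicit half term, and an \<open>X \<bullet> P\<close> that joins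
    \<open>U \<bullet> R\<close> to form \<open>?D\<close>.\<close>
  show "Q_0iii X U P R i j k
      = 3 / 2 * antisymmetrize (\<lambda>m. E_R X U P R (m ! 0) (m ! 1) * ?S $ (m ! 2)) [i, j, k]"
    unfolding Q_0iii_def sum_eps_4 antisymmetrize_E_R_3 S3 E_D_def
    by (simp add: eps_3 eps_2 inner_commute power2_norm_eq_inner field_simps)
  \<comment> \<open>X \<and> P \<and> P vanishes, so only U \<and> R \<and> P survives.\<close>
  show "Q_iiiN X U P R i j k
      = - 3 * antisymmetrize (\<lambda>m. E_R X U P R (m ! 0) (m ! 1) * E_T X U P R $ (m ! 2)) [i, j, k]"
    unfolding Q_iiiN_def antisymmetrize_E_R_3 E_T_def
    by (simp add: eps_3 eps_2 field_simps)
  assume "?D \<noteq> 0"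
  \<comment> \<open>The first summand repeats \<open>P\<close>. In the second, the \<open>P\<close>,
    \<open>R\<close> and \<open>U\<close> terms of \<open>?S\<close> repeat a vector; the
    \<open>X\<close> term remains, and moving \<open>X\<close> to the front is an even
    permutation.\<close>
  have "eps [i, j, k, l] [X, P, ?S, P] + eps [i, j, k, l] [U, R, ?S, P]
      = - 2 * ?D * eps [i, j, k, l] [X, U, R, P]"
    unfolding S4 by (simp add: eps_4 eps_3 eps_2 algebra_simps)
  with \<open>?D \<noteq> 0\<close> show "Q_iiii X U P R i j k l = 6 / ?D
      * antisymmetrize (\<lambda>m. E_R X U P R (m ! 0) (m ! 1) * ?S $ (m ! 2) * E_T X U P R $ (m ! 3)) [i, j, k, l]"
    unfolding Q_iiii_def antisymmetrize_E_R_4 E_T_def by simp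
qed

end
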